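(* The varieties $\mathcal V(\mathbf C_2^\Delta)$ and $\mathcal V(\mathbf C_2^\nabla)$ are axiomatized, within the variety of MV-monoids, by $x\oplus x\approx x$ and $x\odot x\approx x$, respectively. That is, $\mathcal V(\mathbf C_2^\Delta)$ is the class of MV-monoids satisfying $x\oplus x\approx x$, and $\mathcal V(\mathbf C_2^\nabla)$ is the class of MV-monoids satisfying $x\odot x\approx x$.
   Context: An MV-monoid is an algebra $\langle A,\vee,\wedge,\oplus,\odot,0,1\rangle$ such that $\langle A,\vee,\wedge,0,1\rangle$ is a bounded distributive lattice, $\langle A,\oplus,0\rangle$ and $\langle A,\odot,1\rangle$ are commutative monoids, $\oplus$ and $\odot$ both distribute over both $\vee$ and $\wedge$, and for all $x,y,z\in A$: $(x\oplus y)\odot((x\odot y)\oplus z)=(x\odot(y\oplus z))\oplus(y\odot z)$; $(x\odot y)\oplus((x\oplus y)\odot z)=(x\oplus(y\odot z))\odot(y\oplus z)$; $(x\odot y)\oplus z=((x\oplus y)\odot((x\odot y)\oplus z))\vee z$; $(x\oplus y)\odot z=((x\odot y)\oplus((x\oplus y)\odot z))\wedge z$. $\mathcal V(K)$ denotes the variety generated by $K$. $\mathbf C_2^\Delta$ is the unique MV-monoid on the 3-element chain $0<\varepsilon<1$ with $\varepsilon\oplus\varepsilon=\varepsilon$ and $\varepsilon\odot\varepsilon=0$. $\mathbf C_2^\nabla$ is the unique MV-monoid on the 3-element chain $0<\delta<1$ with $\delta\oplus\delta=1$ and $\delta\odot\delta=\delta$. *)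

theory Defs
  imports "HOL-Algebra.Group"
begin

section \<open>MV-monoids\<close>

record 'a mv_alg = "'a partial_object" +
  mv_join :: "['a, 'a] \<Rightarrow> 'a" (infixl \<open>\<^bold>\<or>\<index>\<close> 60)
  mv_meet :: "['a, 'a] \<Rightarrow> 'a" (infixl \<open>\<^bold>\<and>\<index>\<close> 62)
  mv_plus :: "['a, 'a] \<Rightarrow> 'a" (infixl \<open>\<oplus>\<index>\<close> 65)
  mv_times :: "['a, 'a] \<Rightarrow> 'a" (infixl \<open>\<odot>\<index>\<close> 70)
  mv_zero :: 'a (\<open>\<^bold>0\<index>\<close>)
  mv_one :: 'a (\<open>\<^bold>1\<index>\<close>)

locale mv_algebra =
  fixes A :: "'a mv_alg" (structure)
  assumes join_closed: "x \<in> carrier A \<Longrightarrow> y \<in> carrier A \<Longrightarrow> x \<^bold>\<or> y \<in> carrier A"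
    and meet_closed: "x \<in> carrier A \<Longrightarrow> y \<in> carrier A \<Longrightarrow> x \<^bold>\<and> y \<in> carrier A"
    and plus_closed: "x \<in> carrier A \<Longrightarrow> y \<in> carrier A \<Longrightarrow> x \<oplus> y \<in> carrier A"
    and times_closed: "x \<in> carrier A \<Longrightarrow> y \<in> carrier A \<Longrightarrow> x \<odot> y \<in> carrier A"
    and zero_closed: "\<^bold>0 \<in> carrier A"
    and one_closed: "\<^bold>1 \<in> carrier A"

locale mv_bounded_distrib_lattice = mv_algebra +
  assumes join_commute: "x \<in> carrier A \<Longrightarrow> y \<in> carrier A \<Longrightarrow> x \<^bold>\<or> y = y \<^bold>\<or> x"
    and meet_commute: "x \<in> carrier A \<Longrightarrow> y \<in> carrier A \<Longrightarrow> x \<^bold>\<and> y = y \<^bold>\<and> x"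
    and join_assoc: "x \<in> carrier A \<Longrightarrow> y \<in> carrier A \<Longrightarrow> z \<in> carrier A \<Longrightarrow>
      (x \<^bold>\<or> y) \<^bold>\<or> z = x \<^bold>\<or> (y \<^bold>\<or> z)"
    and meet_assoc: "x \<in> carrier A \<Longrightarrow> y \<in> carrier A \<Longrightarrow> z \<in> carrier A \<Longrightarrow>
      (x \<^bold>\<and> y) \<^bold>\<and> z = x \<^bold>\<and> (y \<^bold>\<and> z)"
    and join_meet_absorb: "x \<in> carrier A \<Longrightarrow> y \<in> carrier A \<Longrightarrow> x \<^bold>\<or> (x \<^bold>\<and> y) = x"
    and meet_join_absorb: "x \<in> carrier A \<Longrightarrow> y \<in> carrier A \<Longrightarrow> x \<^bold>\<and> (x \<^bold>\<or> y) = x"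
    and meet_join_distrib: "x \<in> carrier A \<Longrightarrow> y \<in> carrier A \<Longrightarrow> z \<in> carrier A \<Longrightarrow>
      x \<^bold>\<and> (y \<^bold>\<or> z) = (x \<^bold>\<and> y) \<^bold>\<or> (x \<^bold>\<and> z)"
    and zero_join: "x \<in> carrier A \<Longrightarrow> \<^bold>0 \<^bold>\<or> x = x"
    and one_meet: "x \<in> carrier A \<Longrightarrow> \<^bold>1 \<^bold>\<and> x = x"

locale mv_monoid = mv_bounded_distrib_lattice +
  assumes plus_comm_monoid: "comm_monoid \<lparr>carrier = carrier A, mult = (\<oplus>), one = \<^bold>0\<rparr>"
    and times_comm_monoid: "comm_monoid \<lparr>carrier = carrier A, mult = (\<odot>), one = \<^bold>1\<rparr>"
    and plus_join_distrib: "x \<in> carrier A \<Longrightarrow> y \<in> carrier A \<Longrightarrow> z \<in> carrier A \<Longrightarrow>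
      x \<oplus> (y \<^bold>\<or> z) = (x \<oplus> y) \<^bold>\<or> (x \<oplus> z)"
    and plus_meet_distrib: "x \<in> carrier A \<Longrightarrow> y \<in> carrier A \<Longrightarrow> z \<in> carrier A \<Longrightarrow>
      x \<oplus> (y \<^bold>\<and> z) = (x \<oplus> y) \<^bold>\<and> (x \<oplus> z)"
    and times_join_distrib: "x \<in> carrier A \<Longrightarrow> y \<in> carrier A \<Longrightarrow> z \<in> carrier A \<Longrightarrow>
      x \<odot> (y \<^bold>\<or> z) = (x \<odot> y) \<^bold>\<or> (x \<odot> z)"
    and times_meet_distrib: "x \<in> carrier A \<Longrightarrow> y \<in> carrier A \<Longrightarrow> z \<in> carrier A \<Longrightarrow>
      x \<odot> (y \<^bold>\<and> z) = (x \<odot> y) \<^bold>\<and> (x \<odot> z)"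
    and mv_ax1: "x \<in> carrier A \<Longrightarrow> y \<in> carrier A \<Longrightarrow> z \<in> carrier A \<Longrightarrow>
      (x \<oplus> y) \<odot> ((x \<odot> y) \<oplus> z) = (x \<odot> (y \<oplus> z)) \<oplus> (y \<odot> z)"
    and mv_ax2: "x \<in> carrier A \<Longrightarrow> y \<in> carrier A \<Longrightarrow> z \<in> carrier A \<Longrightarrow>
      (x \<odot> y) \<oplus> ((x \<oplus> y) \<odot> z) = (x \<oplus> (y \<odot> z)) \<odot> (y \<oplus> z)"
    and mv_ax3: "x \<in> carrier A \<Longrightarrow> y \<in> carrier A \<Longrightarrow> z \<in> carrier A \<Longrightarrow>
      (x \<odot> y) \<oplus> z = ((x \<oplus> y) \<odot> ((x \<odot> y) \<oplus> z)) \<^bold>\<or> z"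
    and mv_ax4: "x \<in> carrier A \<Longrightarrow> y \<in> carrier A \<Longrightarrow> z \<in> carrier A \<Longrightarrow>
      (x \<oplus> y) \<odot> z = ((x \<odot> y) \<oplus> ((x \<oplus> y) \<odot> z)) \<^bold>\<and> z"


section \<open>Identities and varieties\<close>

datatype 'v mv_term =
    Var 'v
  | Join "'v mv_term" "'v mv_term"
  | Meet "'v mv_term" "'v mv_term"
  | Plus "'v mv_term" "'v mv_term"
  | Times "'v mv_term" "'v mv_term"
  | Zero
  | One

primrec eval_term :: "'a mv_alg \<Rightarrow> ('v \<Rightarrow> 'a) \<Rightarrow> 'v mv_term \<Rightarrow> 'a" where
  "eval_term A v (Var i) = v i"
| "eval_term A v (Join s t) = eval_term A v s \<^bold>\<or>\<^bsub>A\<^esub> eval_term A v t"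
| "eval_term A v (Meet s t) = eval_term A v s \<^bold>\<and>\<^bsub>A\<^esub> eval_term A v t"
| "eval_term A v (Plus s t) = eval_term A v s \<oplus>\<^bsub>A\<^esub> eval_term A v t"
| "eval_term A v (Times s t) = eval_term A v s \<odot>\<^bsub>A\<^esub> eval_term A v t"
| "eval_term A v Zero = \<^bold>0\<^bsub>A\<^esub>"
| "eval_term A v One = \<^bold>1\<^bsub>A\<^esub>"

datatype mv_identity = Identity "nat mv_term" "nat mv_term" (infix \<open>\<approx>\<close> 50)

primrec satisfies :: "'a mv_alg \<Rightarrow> mv_identity \<Rightarrow> bool" (infix \<open>\<Turnstile>\<close> 45) where
  "A \<Turnstile> (s \<approx> t) \<longleftrightarrow> (\<forall>v \<in> UNIV \<rightarrow> carrier A. eval_term A v s = eval_term A v t)"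

text \<open>The variety (equational class) defined by a set of identities.\<close>

definition Mod :: "mv_identity set \<Rightarrow> 'a mv_alg set" where
  "Mod E = {A. mv_algebra A \<and> (\<forall>e \<in> E. A \<Turnstile> e)}"

text \<open>The variety generated by \<open>K\<close> is the least variety containing \<open>K\<close>. A variety is a
  class of algebras over arbitrary carrier types, given by one set \<open>E\<close> of identities; the members
  of \<open>K\<close> and the members of the generated variety may therefore live on different types. The
  result \<open>generated_variety_iff_HSP\<close> below shows that this is the closure of \<open>K\<close> under products,
  subalgebras and homomorphic images.\<close>

definition generated_variety :: "'k mv_alg set \<Rightarrow> 'a mv_alg set" where
  "generated_variety K = \<Inter> {Mod E | E. K \<subseteq> Mod E}"

definition mv_product :: "'i set \<Rightarrow> ('i \<Rightarrow> 'k mv_alg) \<Rightarrow> ('i \<Rightarrow> 'k) mv_alg" where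
  "mv_product I F = \<lparr>carrier = (\<Pi>\<^sub>E i\<in>I. carrier (F i)),
     mv_join = (\<lambda>f g. \<lambda>i\<in>I. f i \<^bold>\<or>\<^bsub>F i\<^esub> g i), mv_meet = (\<lambda>f g. \<lambda>i\<in>I. f i \<^bold>\<and>\<^bsub>F i\<^esub> g i),
     mv_plus = (\<lambda>f g. \<lambda>i\<in>I. f i \<oplus>\<^bsub>F i\<^esub> g i), mv_times = (\<lambda>f g. \<lambda>i\<in>I. f i \<odot>\<^bsub>F i\<^esub> g i),
     mv_zero = (\<lambda>i\<in>I. \<^bold>0\<^bsub>F i\<^esub>), mv_one = (\<lambda>i\<in>I. \<^bold>1\<^bsub>F i\<^esub>)\<rparr>"

definition mv_subalgebra :: "'b set \<Rightarrow> 'b mv_alg \<Rightarrow> bool" where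
  "mv_subalgebra S B \<longleftrightarrow> S \<subseteq> carrier B \<and> mv_algebra (B\<lparr>carrier := S\<rparr>)"

definition mv_hom :: "'b mv_alg \<Rightarrow> 'a mv_alg \<Rightarrow> ('b \<Rightarrow> 'a) set" where
  "mv_hom B A = {h. h \<in> carrier B \<rightarrow> carrier A
     \<and> (\<forall>x\<in>carrier B. \<forall>y\<in>carrier B. h (x \<^bold>\<or>\<^bsub>B\<^esub> y) = h x \<^bold>\<or>\<^bsub>A\<^esub> h y
          \<and> h (x \<^bold>\<and>\<^bsub>B\<^esub> y) = h x \<^bold>\<and>\<^bsub>A\<^esub> h y
          \<and> h (x \<oplus>\<^bsub>B\<^esub> y) = h x \<oplus>\<^bsub>A\<^esub> h y
          \<and> h (x \<odot>\<^bsub>B\<^esub> y) = h x \<odot>\<^bsub>A\<^esub> h y)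
     \<and> h \<^bold>0\<^bsub>B\<^esub> = \<^bold>0\<^bsub>A\<^esub> \<and> h \<^bold>1\<^bsub>B\<^esub> = \<^bold>1\<^bsub>A\<^esub>}"

lemma generated_variety_altdef:
  assumes "\<And>B. B \<in> K \<Longrightarrow> mv_algebra B"
  shows "A \<in> generated_variety K \<longleftrightarrow>
    mv_algebra A \<and> (\<forall>e. (\<forall>B\<in>K. B \<Turnstile> e) \<longrightarrow> A \<Turnstile> e)" (is "?l \<longleftrightarrow> ?r")
proof
  assume l: ?l
  have "K \<subseteq> Mod {e. \<forall>B\<in>K. B \<Turnstile> e}"
    using assms by (auto simp: Mod_def)
  then have "A \<in> Mod {e. \<forall>B\<in>K. B \<Turnstile> e}"
    using l unfolding generated_variety_def by blast
  then show ?r by (auto simp: Mod_def)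
qed (auto simp: generated_variety_def Mod_def)

lemma eval_term_closed:
  assumes "mv_algebra A" "\<And>i. i \<in> set_mv_term t \<Longrightarrow> v i \<in> carrier A"
  shows "eval_term A v t \<in> carrier A"
proof -
  interpret mv_algebra A by fact
  show ?thesis using assms(2)
    by (induction t)
      (auto intro: join_closed meet_closed plus_closed times_closed zero_closed one_closed)
qed

lemma eval_term_cong:
  "(\<And>i. i \<in> set_mv_term t \<Longrightarrow> v i = w i) \<Longrightarrow> eval_term A v t = eval_term A w t"
  by (induction t) simp_all

lemma eval_term_map: "eval_term A v (map_mv_term r t) = eval_term A (v \<circ> r) t"
  by (induction t) simp_all

lemma eval_term_hom:
  assumes "mv_algebra B" "h \<in> mv_hom B A" "\<And>i. v i \<in> carrier B"
  shows "eval_term A (h \<circ> v) t = h (eval_term B v t)"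
proof -
  have "eval_term B v u \<in> carrier B" for u
    using assms by (intro eval_term_closed)
  then show ?thesis
    using assms(2) by (induction t) (simp_all add: mv_hom_def)
qed

lemma eval_term_product:
  assumes "i \<in> I"
  shows "eval_term (mv_product I F \<lparr>carrier := S\<rparr>) v t i = eval_term (F i) (\<lambda>n. v n i) t"
  by (induction t) (use assms in \<open>auto simp: mv_product_def\<close>)

lemma eval_term_product_extensional:
  assumes "\<And>n. v n \<in> extensional I"
  shows "eval_term (mv_product I F \<lparr>carrier := S\<rparr>) v t \<in> extensional I"
proof (cases t)
  case (Var n)
  then show ?thesis using assms by simp
qed (simp_all add: mv_product_def)

theorem HSP_in_generated_variety:
  assumes K: "\<And>B. B \<in> K \<Longrightarrow> mv_algebra B"
    and F: "\<And>i. i \<in> I \<Longrightarrow> F i \<in> K"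
    and S: "mv_subalgebra S (mv_product I F)"
    and h: "h \<in> mv_hom (mv_product I F \<lparr>carrier := S\<rparr>) A" "h ` S = carrier A"
  shows "A \<in> generated_variety K"
proof -
  let ?P = "mv_product I F \<lparr>carrier := S\<rparr>"
  have P: "mv_algebra ?P"
    using S by (simp add: mv_subalgebra_def)
  interpret P: mv_algebra ?P by fact
  have ops: "h (x \<^bold>\<or>\<^bsub>?P\<^esub> y) = h x \<^bold>\<or>\<^bsub>A\<^esub> h y" "h (x \<^bold>\<and>\<^bsub>?P\<^esub> y) = h x \<^bold>\<and>\<^bsub>A\<^esub> h y"
    "h (x \<oplus>\<^bsub>?P\<^esub> y) = h x \<oplus>\<^bsub>A\<^esub> h y" "h (x \<odot>\<^bsub>?P\<^esub> y) = h x \<odot>\<^bsub>A\<^esub> h y"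
    "h \<^bold>0\<^bsub>?P\<^esub> = \<^bold>0\<^bsub>A\<^esub>" "h \<^bold>1\<^bsub>?P\<^esub> = \<^bold>1\<^bsub>A\<^esub>"
    if "x \<in> S" "y \<in> S" for x y
    using h(1) that unfolding mv_hom_def by simp_all
  have hS: "h x \<in> carrier A" if "x \<in> S" for x
    using h(2) that by blast
  have zS: "\<^bold>0\<^bsub>?P\<^esub> \<in> S"
    using P.zero_closed by simp
  have "mv_algebra A"
  proof
    fix x y assume "x \<in> carrier A" "y \<in> carrier A"
    then obtain a b where ab: "a \<in> S" "b \<in> S" "x = h a" "y = h b"
      using h(2) by blast
    show "x \<^bold>\<or>\<^bsub>A\<^esub> y \<in> carrier A"
      using ops(1)[OF ab(1,2)] hS[of "a \<^bold>\<or>\<^bsub>?P\<^esub> b"] P.join_closed[of a b] ab by simp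
    show "x \<^bold>\<and>\<^bsub>A\<^esub> y \<in> carrier A"
      using ops(2)[OF ab(1,2)] hS[of "a \<^bold>\<and>\<^bsub>?P\<^esub> b"] P.meet_closed[of a b] ab by simp
    show "x \<oplus>\<^bsub>A\<^esub> y \<in> carrier A"
      using ops(3)[OF ab(1,2)] hS[of "a \<oplus>\<^bsub>?P\<^esub> b"] P.plus_closed[of a b] ab by simp
    show "x \<odot>\<^bsub>A\<^esub> y \<in> carrier A"
      using ops(4)[OF ab(1,2)] hS[of "a \<odot>\<^bsub>?P\<^esub> b"] P.times_closed[of a b] ab by simp
  next
    show "\<^bold>0\<^bsub>A\<^esub> \<in> carrier A"
      using ops(5)[OF zS zS] hS[OF zS] by simp
    show "\<^bold>1\<^bsub>A\<^esub> \<in> carrier A"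
      using ops(6)[OF zS zS] hS[of "\<^bold>1\<^bsub>?P\<^esub>"] P.one_closed by simp
  qed
  moreover have "A \<Turnstile> e" if e: "\<forall>B\<in>K. B \<Turnstile> e" for e
  proof (cases e)
    case (Identity s t)
    have "eval_term A v s = eval_term A v t" if v: "v \<in> UNIV \<rightarrow> carrier A" for v
    proof -
      define w where "w n = (SOME x. x \<in> S \<and> h x = v n)" for n
      have w: "w n \<in> S \<and> h (w n) = v n" for n
      proof -
        have "\<exists>x. x \<in> S \<and> h x = v n"
          using v h(2) by (metis PiE UNIV_I imageE)
        then show ?thesis unfolding w_def by (rule someI_ex)
      qed
      have wP: "w n \<in> carrier (mv_product I F)" for n
        using w S by (auto simp: mv_subalgebra_def)
      have "eval_term ?P w s = eval_term ?P w t"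
      proof (rule extensionalityI[of _ I])
        have "w n \<in> extensional I" for n
          using wP[of n] by (simp add: mv_product_def PiE_iff)
        then show "eval_term ?P w s \<in> extensional I" "eval_term ?P w t \<in> extensional I"
          by (simp_all add: eval_term_product_extensional)
        fix i assume i: "i \<in> I"
        have "(\<lambda>n. w n i) \<in> UNIV \<rightarrow> carrier (F i)"
          using wP i by (auto simp: mv_product_def)
        then show "eval_term ?P w s i = eval_term ?P w t i"
          using e F[OF i] Identity i by (simp add: eval_term_product)
      qed
      moreover have "h \<circ> w = v"
        using w by auto
      ultimately show ?thesis
        using eval_term_hom[OF P h(1), of w s] eval_term_hom[OF P h(1), of w t] w by simp
    qed
    then show ?thesis using Identity by simp
  qed
  ultimately show ?thesis
    using generated_variety_altdef[OF K] by blast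
qed

text \<open>Pairs of a member of \<open>K\<close> and a valuation in it suffice as indices, since the free algebra
  over \<open>carrier A\<close> embeds in the corresponding product. \<open>HSP_in_generated_variety\<close> allows any
  index type.\<close>

theorem generated_variety_iff_HSP:
  fixes K :: "'k mv_alg set" and A :: "'a mv_alg"
  assumes K: "\<And>B. B \<in> K \<Longrightarrow> mv_algebra B"
  shows "A \<in> generated_variety K \<longleftrightarrow>
    (\<exists>(I :: ('k mv_alg \<times> ('a \<Rightarrow> 'k)) set) F S h. (\<forall>i\<in>I. F i \<in> K)
       \<and> mv_subalgebra S (mv_product I F)
       \<and> h \<in> mv_hom (mv_product I F \<lparr>carrier := S\<rparr>) A \<and> h ` S = carrier A)"
    (is "_ \<longleftrightarrow> ?HSP")
proof
  assume "A \<in> generated_variety K"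
  then have "mv_algebra A" and sat: "\<And>e. (\<forall>B\<in>K. B \<Turnstile> e) \<Longrightarrow> A \<Turnstile> e"
    using generated_variety_altdef[OF K] by blast+
  interpret A: mv_algebra A by fact
  define I :: "('k mv_alg \<times> ('a \<Rightarrow> 'k)) set" where
    "I = {(B, v). B \<in> K \<and> v \<in> carrier A \<rightarrow> carrier B}"
  define ev where "ev t = (\<lambda>i\<in>I. eval_term (fst i) (snd i) t)" for t
  define T where "T = {t. set_mv_term t \<subseteq> carrier A}"
  define h where "h f = eval_term A id (SOME t. t \<in> T \<and> ev t = f)" for f
  let ?P = "mv_product I fst"
  let ?S = "ev ` T"

  have well_defined: "eval_term A id s = eval_term A id t"
    if st: "s \<in> T" "t \<in> T" "ev s = ev t" for s t
  proof -
    let ?V = "set_mv_term s \<union> set_mv_term t"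
    have "finite (set_mv_term u)" for u :: "'a mv_term"
      by (induction u) auto
    then obtain r :: "'a \<Rightarrow> nat" where r: "inj_on r ?V"
      using finite_imp_inj_to_nat_seg[of ?V] by blast
    have "B \<Turnstile> (map_mv_term r s \<approx> map_mv_term r t)" if B: "B \<in> K" for B
    proof -
      have "eval_term B (v \<circ> r) s = eval_term B (v \<circ> r) t" if "v \<in> UNIV \<rightarrow> carrier B" for v
      proof -
        have "(B, v \<circ> r) \<in> I"
          using that B by (auto simp: I_def)
        then show ?thesis
          using fun_cong[OF st(3), of "(B, v \<circ> r)"] by (simp add: ev_def)
      qed
      then show ?thesis by (simp add: eval_term_map)
    qed
    then have *: "A \<Turnstile> (map_mv_term r s \<approx> map_mv_term r t)"
      using sat by blast
    define w where "w n = (if n \<in> r ` ?V then inv_into ?V r n else \<^bold>0\<^bsub>A\<^esub>)" for n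
    have wr: "(w \<circ> r) a = id a" if "a \<in> ?V" for a
      using that r by (simp add: w_def)
    have "w n \<in> carrier A" for n
    proof (cases "n \<in> r ` ?V")
      case True
      then have "inv_into ?V r n \<in> ?V"
        by (rule inv_into_into)
      then show ?thesis
        using True st(1,2) by (auto simp: w_def T_def)
    qed (use A.zero_closed in \<open>simp add: w_def\<close>)
    then have "eval_term A (w \<circ> r) s = eval_term A (w \<circ> r) t"
      using * by (simp add: eval_term_map)
    moreover have "eval_term A (w \<circ> r) s = eval_term A id s"
      "eval_term A (w \<circ> r) t = eval_term A id t"
      by (rule eval_term_cong; use wr in blast)+
    ultimately show ?thesis by simp
  qed
  have h_ev: "h (ev t) = eval_term A id t" if "t \<in> T" for t
  proof -
    have "(SOME s. s \<in> T \<and> ev s = ev t) \<in> T \<and> ev (SOME s. s \<in> T \<and> ev s = ev t) = ev t"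
      by (rule someI[of _ t]) (use that in simp)
    then show ?thesis
      unfolding h_def using well_defined that by blast
  qed

  have ops: "ev s \<^bold>\<or>\<^bsub>?P\<^esub> ev t = ev (Join s t)" "ev s \<^bold>\<and>\<^bsub>?P\<^esub> ev t = ev (Meet s t)"
    "ev s \<oplus>\<^bsub>?P\<^esub> ev t = ev (Plus s t)" "ev s \<odot>\<^bsub>?P\<^esub> ev t = ev (Times s t)"
    "\<^bold>0\<^bsub>?P\<^esub> = ev Zero" "\<^bold>1\<^bsub>?P\<^esub> = ev One" for s t
    by (auto simp: mv_product_def ev_def)
  have T: "Join s t \<in> T" "Meet s t \<in> T" "Plus s t \<in> T" "Times s t \<in> T" "Zero \<in> T" "One \<in> T"
    if "s \<in> T" "t \<in> T" for s t
    using that by (auto simp: T_def)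
  have T0: "Zero \<in> T"
    by (simp add: T_def)
  have "?S \<subseteq> carrier ?P"
  proof
    fix f assume "f \<in> ?S"
    then obtain t where t: "t \<in> T" "f = ev t" by blast
    have "eval_term B v t \<in> carrier B" if "(B, v) \<in> I" for B v
      using that t(1) K by (intro eval_term_closed) (auto simp: I_def T_def)
    then show "f \<in> carrier ?P"
      by (auto simp: t(2) mv_product_def ev_def)
  qed
  moreover have "mv_algebra (?P\<lparr>carrier := ?S\<rparr>)"
    by unfold_locales (auto simp: ops T T[OF T0 T0])
  ultimately have "mv_subalgebra ?S ?P"
    by (simp add: mv_subalgebra_def)
  moreover have "h ` ?S = carrier A"
  proof (intro equalityI subsetI)
    fix a assume "a \<in> h ` ?S"
    then obtain t where "t \<in> T" "a = eval_term A id t"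
      using h_ev by auto
    then show "a \<in> carrier A"
      using eval_term_closed[OF \<open>mv_algebra A\<close>, of t id] by (auto simp: T_def)
  next
    fix a assume "a \<in> carrier A"
    then have "Var a \<in> T" by (simp add: T_def)
    then show "a \<in> h ` ?S"
      using h_ev[of "Var a"] by force
  qed
  moreover from this have "h \<in> mv_hom (?P\<lparr>carrier := ?S\<rparr>) A"
    by (auto simp: mv_hom_def ops T h_ev T[OF T0 T0])
  moreover have "\<forall>i\<in>I. fst i \<in> K"
    by (auto simp: I_def)
  ultimately show ?HSP by blast
next
  assume ?HSP
  then show "A \<in> generated_variety K"
    by (elim exE conjE) (rule HSP_in_generated_variety[OF K]; simp)
qed


section \<open>The three-element algebras\<close>

datatype chain3 = Bot | Mid | Top

instantiation chain3 :: linorder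
begin

primrec rank3 :: "chain3 \<Rightarrow> nat" where
  "rank3 Bot = 0"
| "rank3 Mid = 1"
| "rank3 Top = 2"

definition less_eq_chain3 :: "chain3 \<Rightarrow> chain3 \<Rightarrow> bool" where
  "x \<le> y \<longleftrightarrow> rank3 x \<le> rank3 y"

definition less_chain3 :: "chain3 \<Rightarrow> chain3 \<Rightarrow> bool" where
  "x < y \<longleftrightarrow> rank3 x < rank3 y"

instance
proof
  fix x y :: chain3
  show "x \<le> y \<Longrightarrow> y \<le> x \<Longrightarrow> x = y"
    by (cases x; cases y) (auto simp: less_eq_chain3_def)
qed (auto simp: less_eq_chain3_def less_chain3_def)

end

text \<open>\<open>Mid\<close> is \<open>\<epsilon>\<close> in \<open>C2_Delta\<close> and \<open>\<delta>\<close> in \<open>C2_Nabla\<close>. The values of \<open>\<oplus>\<close> and \<open>\<odot>\<close> other than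
  at \<open>(Mid, Mid)\<close> are forced by the axioms; see \<open>C2_Delta_unique\<close> and \<open>C2_Nabla_unique\<close>.\<close>

definition C2_Delta :: "chain3 mv_alg" where
  "C2_Delta = \<lparr>carrier = UNIV, mv_join = max, mv_meet = min,
     mv_plus = (\<lambda>x y. if x = Bot then y else if y = Bot then x
                       else if x = Mid \<and> y = Mid then Mid else Top),
     mv_times = (\<lambda>x y. if x = Top then y else if y = Top then x
                       else Bot),
     mv_zero = Bot, mv_one = Top\<rparr>"

definition C2_Nabla :: "chain3 mv_alg" where
  "C2_Nabla = \<lparr>carrier = UNIV, mv_join = max, mv_meet = min,
     mv_plus = (\<lambda>x y. if x = Bot then y else if y = Bot then x
                       else Top),
     mv_times = (\<lambda>x y. if x = Top then y else if y = Top then x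
                       else if x = Mid \<and> y = Mid then Mid else Bot),
     mv_zero = Bot, mv_one = Top\<rparr>"

lemma chain3_forall: "(\<forall>x. P x) \<longleftrightarrow> P Bot \<and> P Mid \<and> P Top"
  by (metis chain3.exhaust)

lemma chain3_max_min [simp]:
  "max Bot x = x" "max x Bot = x" "max Top x = Top" "max x Top = Top" "max Mid Mid = Mid"
  "min Bot x = Bot" "min x Bot = Bot" "min Top x = x" "min x Top = x" "min Mid Mid = Mid"
  for x :: chain3
  by (cases x; simp add: max_def min_def less_eq_chain3_def)+

lemma mv_monoid_C2_Delta: "mv_monoid C2_Delta"
  by unfold_locales
    ((atomize (full))?, simp add: C2_Delta_def chain3_forall Units_def)+

lemma mv_monoid_C2_Nabla: "mv_monoid C2_Nabla"
  by unfold_locales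
    ((atomize (full))?, simp add: C2_Nabla_def chain3_forall Units_def)+

context mv_monoid
begin

lemma plus_rules:
  assumes "x \<in> carrier A" "y \<in> carrier A"
  shows "\<^bold>0 \<oplus> x = x" "x \<oplus> \<^bold>0 = x" "x \<oplus> y = y \<oplus> x" "\<^bold>1 \<oplus> x = \<^bold>1" "x \<oplus> \<^bold>1 = \<^bold>1"
proof -
  interpret P: comm_monoid "\<lparr>carrier = carrier A, mult = (\<oplus>), one = \<^bold>0\<rparr>"
    by (rule plus_comm_monoid)
  show *: "\<^bold>0 \<oplus> x = x" "x \<oplus> \<^bold>0 = x" "x \<oplus> y = y \<oplus> x"
    using P.l_one P.r_one P.m_comm assms by auto
  have "\<^bold>1 \<oplus> x = \<^bold>1 \<oplus> (\<^bold>0 \<^bold>\<or> x)"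
    using assms by (simp add: zero_join)
  also have "\<dots> = (\<^bold>1 \<oplus> \<^bold>0) \<^bold>\<or> (\<^bold>1 \<oplus> x)"
    by (intro plus_join_distrib one_closed zero_closed assms)
  also have "\<^bold>1 \<oplus> \<^bold>0 = \<^bold>1"
    using P.r_one[of "\<^bold>1"] one_closed by simp
  also have "\<^bold>1 \<^bold>\<or> (\<^bold>1 \<oplus> x) = \<^bold>1"
    using join_meet_absorb[OF one_closed plus_closed[OF one_closed assms(1)]]
      one_meet[OF plus_closed[OF one_closed assms(1)]] by simp
  finally show "\<^bold>1 \<oplus> x = \<^bold>1" .
  then show "x \<oplus> \<^bold>1 = \<^bold>1"
    using P.m_comm[of x "\<^bold>1"] assms one_closed by simp
qed

lemma times_rules:
  assumes "x \<in> carrier A" "y \<in> carrier A"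
  shows "\<^bold>1 \<odot> x = x" "x \<odot> \<^bold>1 = x" "x \<odot> y = y \<odot> x" "\<^bold>0 \<odot> x = \<^bold>0" "x \<odot> \<^bold>0 = \<^bold>0"
proof -
  interpret P: comm_monoid "\<lparr>carrier = carrier A, mult = (\<odot>), one = \<^bold>1\<rparr>"
    by (rule times_comm_monoid)
  show *: "\<^bold>1 \<odot> x = x" "x \<odot> \<^bold>1 = x" "x \<odot> y = y \<odot> x"
    using P.l_one P.r_one P.m_comm assms by auto
  have "\<^bold>0 \<odot> x = \<^bold>0 \<odot> (\<^bold>1 \<^bold>\<and> x)"
    using assms by (simp add: one_meet)
  also have "\<dots> = (\<^bold>0 \<odot> \<^bold>1) \<^bold>\<and> (\<^bold>0 \<odot> x)"
    by (intro times_meet_distrib one_closed zero_closed assms)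
  also have "\<^bold>0 \<odot> \<^bold>1 = \<^bold>0"
    using P.r_one[of "\<^bold>0"] zero_closed by simp
  also have "\<^bold>0 \<^bold>\<and> (\<^bold>0 \<odot> x) = \<^bold>0"
    using meet_join_absorb[OF zero_closed times_closed[OF zero_closed assms(1)]]
      zero_join[OF times_closed[OF zero_closed assms(1)]] by simp
  finally show "\<^bold>0 \<odot> x = \<^bold>0" .
  then show "x \<odot> \<^bold>0 = \<^bold>0"
    using P.m_comm[of x "\<^bold>0"] assms zero_closed by simp
qed

end

lemma chain3_ext2:
  "f = g" if "\<And>x. f Bot x = g Bot x" "\<And>x. f x Bot = g x Bot" "\<And>x. f Top x = g Top x"
    "\<And>x. f x Top = g x Top" "f Mid Mid = g Mid Mid" for f g :: "chain3 \<Rightarrow> chain3 \<Rightarrow> 'b"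
  using that by (intro ext) (metis chain3.exhaust)

lemma mv_monoid_chain3_eqI:
  fixes A B :: "chain3 mv_alg"
  assumes A: "mv_monoid A" "carrier A = UNIV" "mv_join A = max" "mv_meet A = min"
    and B: "mv_monoid B" "carrier B = UNIV" "mv_join B = max" "mv_meet B = min"
    and "Mid \<oplus>\<^bsub>A\<^esub> Mid = Mid \<oplus>\<^bsub>B\<^esub> Mid" "Mid \<odot>\<^bsub>A\<^esub> Mid = Mid \<odot>\<^bsub>B\<^esub> Mid"
  shows "A = B"
proof -
  interpret A: mv_monoid A by fact
  interpret B: mv_monoid B by fact
  have bounds: "\<^bold>0\<^bsub>A\<^esub> = Bot" "\<^bold>1\<^bsub>A\<^esub> = Top" "\<^bold>0\<^bsub>B\<^esub> = Bot" "\<^bold>1\<^bsub>B\<^esub> = Top"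
    using A.zero_join[of Bot] A.one_meet[of Top] B.zero_join[of Bot] B.one_meet[of Top] A B
    by simp_all
  have "mv_plus A = mv_plus B"
    using A.plus_rules B.plus_rules A B bounds assms by (intro chain3_ext2) simp_all
  moreover have "mv_times A = mv_times B"
    using A.times_rules B.times_rules A B bounds assms by (intro chain3_ext2) simp_all
  ultimately show ?thesis
    using A B bounds by (intro mv_alg.equality) simp_all
qed

lemma C2_Delta_unique:
  "\<exists>!A. mv_monoid A \<and> carrier A = UNIV \<and> mv_join A = max \<and> mv_meet A = min
     \<and> Mid \<oplus>\<^bsub>A\<^esub> Mid = Mid \<and> Mid \<odot>\<^bsub>A\<^esub> Mid = Bot" (is "\<exists>!A. ?P A")
proof (rule ex1I)
  show "?P C2_Delta"
    using mv_monoid_C2_Delta by (simp add: C2_Delta_def)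
  then show "A = C2_Delta" if "?P A" for A
    using that by (intro mv_monoid_chain3_eqI) simp_all
qed

lemma C2_Nabla_unique:
  "\<exists>!A. mv_monoid A \<and> carrier A = UNIV \<and> mv_join A = max \<and> mv_meet A = min
     \<and> Mid \<oplus>\<^bsub>A\<^esub> Mid = Top \<and> Mid \<odot>\<^bsub>A\<^esub> Mid = Mid" (is "\<exists>!A. ?P A")
proof (rule ex1I)
  show "?P C2_Nabla"
    using mv_monoid_C2_Nabla by (simp add: C2_Nabla_def)
  then show "A = C2_Nabla" if "?P A" for A
    using that by (intro mv_monoid_chain3_eqI) simp_all
qed

end

(* When \<oplus> is idempotent it coincides with \<or>. Then every prime filter G of the lattice reduct
   yields a homomorphism to C2_Delta: it sends x to Top if x \<odot> y lies in G for all y in G,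
   to Mid if x is any other element of G, and to Bot otherwise; compatibility with \<odot> is where
   mv_ax4 enters. Since prime filters separate points, the algebra embeds in a power of C2_Delta. The
   second half follows by order duality. *)

theory Submission
  imports Defs
begin

section \<open>Prime filters\<close>

context mv_bounded_distrib_lattice
begin

lemma join_idem: "x \<in> carrier A \<Longrightarrow> x \<^bold>\<or> x = x"
  by (metis join_meet_absorb meet_join_absorb join_closed)

lemma meet_idem: "x \<in> carrier A \<Longrightarrow> x \<^bold>\<and> x = x"
  by (metis join_meet_absorb meet_join_absorb meet_closed)

lemma zero_meet:
  assumes "x \<in> carrier A"
  shows "\<^bold>0 \<^bold>\<and> x = \<^bold>0"
  using assms meet_join_absorb[of "\<^bold>0" x] zero_join zero_closed by simp

text \<open>Expanding the right side by \<open>meet_join_distrib\<close> and absorbing proves this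
  law. It makes the join with a fixed element preserve meets, and it makes the dual lattice
  distributive.\<close>

lemma join_meet_distrib:
  assumes [simp]: "x \<in> carrier A" "y \<in> carrier A" "z \<in> carrier A"
  shows "x \<^bold>\<or> (y \<^bold>\<and> z) = (x \<^bold>\<or> y) \<^bold>\<and> (x \<^bold>\<or> z)"
proof -
  note [simp] = join_closed meet_closed
  have "(x \<^bold>\<or> y) \<^bold>\<and> (x \<^bold>\<or> z) = ((x \<^bold>\<or> y) \<^bold>\<and> x) \<^bold>\<or> ((x \<^bold>\<or> y) \<^bold>\<and> z)"
    by (intro meet_join_distrib) simp_all
  also have "(x \<^bold>\<or> y) \<^bold>\<and> x = x"
    using meet_commute[of "x \<^bold>\<or> y" x] by (simp add: meet_join_absorb)
  also have "(x \<^bold>\<or> y) \<^bold>\<and> z = (z \<^bold>\<and> x) \<^bold>\<or> (y \<^bold>\<and> z)"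
    using meet_commute[of "x \<^bold>\<or> y" z] meet_commute[of y z] by (simp add: meet_join_distrib)
  also have "x \<^bold>\<or> ((z \<^bold>\<and> x) \<^bold>\<or> (y \<^bold>\<and> z)) = (x \<^bold>\<or> (x \<^bold>\<and> z)) \<^bold>\<or> (y \<^bold>\<and> z)"
    using meet_commute[of z x] by (simp add: join_assoc)
  finally show ?thesis by (simp add: join_meet_absorb)
qed

text \<open>The equivalence encodes closure under meets and, read from left to right, being an
  up-set. The whole carrier counts as a filter.\<close>

definition lattice_filter :: "'a set \<Rightarrow> bool" where
  "lattice_filter F \<longleftrightarrow> F \<subseteq> carrier A \<and> \<^bold>1 \<in> F
     \<and> (\<forall>x\<in>carrier A. \<forall>y\<in>carrier A. x \<^bold>\<and> y \<in> F \<longleftrightarrow> x \<in> F \<and> y \<in> F)"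

text \<open>Equivalently, the characteristic function of \<open>F\<close> is a homomorphism of
  bounded lattices onto the two-element chain.\<close>

definition prime_filter :: "'a set \<Rightarrow> bool" where
  "prime_filter F \<longleftrightarrow> lattice_filter F \<and> \<^bold>0 \<notin> F
     \<and> (\<forall>x\<in>carrier A. \<forall>y\<in>carrier A. x \<^bold>\<or> y \<in> F \<longleftrightarrow> x \<in> F \<or> y \<in> F)"

lemma lattice_filter_joinI:
  assumes "lattice_filter F" "x \<in> F" "y \<in> carrier A"
  shows "x \<^bold>\<or> y \<in> F" "y \<^bold>\<or> x \<in> F"
proof -
  have "x \<in> carrier A" using assms by (auto simp: lattice_filter_def)
  then show "x \<^bold>\<or> y \<in> F"
    using assms meet_join_absorb[of x y] join_closed[of x y] unfolding lattice_filter_def by metis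
  then show "y \<^bold>\<or> x \<in> F"
    using join_commute[of x y] \<open>x \<in> carrier A\<close> assms by simp
qed

text \<open>By \<open>join_meet_distrib\<close> the join with \<open>y\<close> preserves meets, so
  it pulls filters back to filters. The primality argument enlarges a maximal filter in this
  way.\<close>

lemma lattice_filter_join_preimage:
  assumes F: "lattice_filter F" and y: "y \<in> carrier A"
  shows "lattice_filter {z \<in> carrier A. y \<^bold>\<or> z \<in> F}"
proof -
  have "y \<^bold>\<or> \<^bold>1 \<in> F"
    using lattice_filter_joinI[OF F _ y] F by (auto simp: lattice_filter_def)
  then show ?thesis
    using F y by (auto simp: lattice_filter_def one_closed meet_closed join_closed join_meet_distrib)
qed

text \<open>The up-set of \<open>a\<close>, with a \<le> x written as a meet, shows that the family
  used in Zorn's lemma is nonempty.\<close>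

lemma lattice_filter_principal:
  assumes "a \<in> carrier A"
  shows "lattice_filter {x \<in> carrier A. a \<^bold>\<and> x = a}"
proof -
  have "a \<^bold>\<and> (x \<^bold>\<and> y) = a \<longleftrightarrow> a \<^bold>\<and> x = a \<and> a \<^bold>\<and> y = a"
    if "x \<in> carrier A" "y \<in> carrier A" for x y
    using that assms by (metis meet_assoc meet_commute meet_closed meet_idem)
  moreover have "a \<^bold>\<and> \<^bold>1 = a"
    using assms by (metis meet_commute one_meet one_closed)
  ultimately show ?thesis
    by (simp add: lattice_filter_def one_closed meet_closed)
qed

text \<open>The hypothesis \<open>ab\<close> says that a \<le> b fails. By Zorn's lemma some filter
  is maximal among those that contain \<open>a\<close> and omit \<open>b\<close>, and maximality
  makes it prime.\<close>

lemma prime_filter_exists: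
  assumes a: "a \<in> carrier A" and b: "b \<in> carrier A" and ab: "a \<^bold>\<and> b \<noteq> a"
  shows "\<exists>F. prime_filter F \<and> a \<in> F \<and> b \<notin> F"
proof -
  let ?S = "{F. lattice_filter F \<and> a \<in> F \<and> b \<notin> F}"
  have "{x \<in> carrier A. a \<^bold>\<and> x = a} \<in> ?S"
    using lattice_filter_principal[OF a] a ab by (simp add: meet_idem)
  then have "?S \<noteq> {}" by blast
  then obtain M where M: "M \<in> ?S" and max: "\<And>F. F \<in> ?S \<Longrightarrow> M \<subseteq> F \<Longrightarrow> F = M"
  proof (rule subset_Zorn_nonempty[THEN bexE])
    fix C assume C: "C \<noteq> {}" "subset.chain ?S C"
    have filt: "lattice_filter F" "a \<in> F" "b \<notin> F" if "F \<in> C" for F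
      using C that by (auto simp: subset.chain_def)
    \<comment> \<open>Members of a chain are comparable, so \<open>x\<close> and \<open>y\<close>
      already lie in a common one.\<close>
    have meet: "x \<^bold>\<and> y \<in> \<Union>C" if "x \<in> F" "y \<in> G" "F \<in> C" "G \<in> C" for x y F G
    proof -
      have "F \<subseteq> G \<or> G \<subseteq> F"
        using C that by (auto simp: subset_chain_def)
      then obtain H where "H \<in> C" "x \<in> H" "y \<in> H"
        using \<open>x \<in> F\<close> \<open>y \<in> G\<close> \<open>F \<in> C\<close> \<open>G \<in> C\<close> by blast
      then show ?thesis
        using filt(1)[of H] unfolding lattice_filter_def by blast
    qed
    have "lattice_filter (\<Union>C)"
      unfolding lattice_filter_def
    proof (intro conjI ballI iffI)
      show "\<Union>C \<subseteq> carrier A" "\<^bold>1 \<in> \<Union>C"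
        using C(1) filt(1) unfolding lattice_filter_def by blast+
    next
      fix x y assume "x \<in> carrier A" "y \<in> carrier A" "x \<^bold>\<and> y \<in> \<Union>C"
      then show "x \<in> \<Union>C" "y \<in> \<Union>C"
        using filt(1) unfolding lattice_filter_def by blast+
    qed (use meet in blast)
    then show "\<Union>C \<in> ?S"
      using C(1) filt(2,3) by auto
  qed blast
  have filt: "lattice_filter M" and bM: "b \<notin> M"
    using M by auto
  \<comment> \<open>The filter \<open>?N\<close> contains \<open>M\<close> and also
    \<open>x\<close>, so it is strictly larger, and maximality forces \<open>b\<close> into
    it.\<close>
  have grow: "b \<^bold>\<or> y \<in> M" if xy: "y \<^bold>\<or> x \<in> M" "x \<notin> M" "x \<in> carrier A" "y \<in> carrier A" for x y
  proof -
    let ?N = "{z \<in> carrier A. y \<^bold>\<or> z \<in> M}"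
    have N: "lattice_filter ?N" by (rule lattice_filter_join_preimage[OF filt xy(4)])
    have "M \<subseteq> ?N"
      using lattice_filter_joinI(2)[OF filt _ xy(4)] filt by (auto simp: lattice_filter_def)
    moreover have "?N \<noteq> M" using xy by auto
    ultimately have "b \<in> ?N"
      using max[of ?N] N M by blast
    then show ?thesis using join_commute[OF b xy(4)] by simp
  qed
  \<comment> \<open>Two uses of \<open>grow\<close> replace first \<open>y\<close> and then
    \<open>x\<close> by \<open>b\<close>, which puts b \<or> b = b into \<open>M\<close>.\<close>
  have "x \<in> M \<or> y \<in> M" if "x \<^bold>\<or> y \<in> M" "x \<in> carrier A" "y \<in> carrier A" for x y
  proof (rule ccontr)
    assume n: "\<not> (x \<in> M \<or> y \<in> M)"
    then have "b \<^bold>\<or> x \<in> M" using grow[of x y] that by simp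
    then have "b \<^bold>\<or> b \<in> M" using grow[of b x] n that b by simp
    then show False using bM b by (simp add: join_idem)
  qed
  moreover have "\<^bold>0 \<notin> M"
    using zero_meet[OF b] filt bM b zero_closed unfolding lattice_filter_def by metis
  ultimately have "prime_filter M"
    using filt lattice_filter_joinI[OF filt] by (auto simp: prime_filter_def)
  then show ?thesis using M by blast
qed

end


section \<open>Algebras with idempotent sum\<close>

context mv_monoid
begin

lemma plus_assoc:
  assumes "x \<in> carrier A" "y \<in> carrier A" "z \<in> carrier A"
  shows "(x \<oplus> y) \<oplus> z = x \<oplus> (y \<oplus> z)"
proof -
  interpret P: comm_monoid "\<lparr>carrier = carrier A, mult = (\<oplus>), one = \<^bold>0\<rparr>"
    by (rule plus_comm_monoid)
  show ?thesis using P.m_assoc assms by simp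
qed

lemma times_assoc:
  assumes "x \<in> carrier A" "y \<in> carrier A" "z \<in> carrier A"
  shows "(x \<odot> y) \<odot> z = x \<odot> (y \<odot> z)"
proof -
  interpret P: comm_monoid "\<lparr>carrier = carrier A, mult = (\<odot>), one = \<^bold>1\<rparr>"
    by (rule times_comm_monoid)
  show ?thesis using P.m_assoc assms by simp
qed

text \<open>Distributing \<open>x\<close> over the meet of 1 and \<open>y\<close> gives this form of
  x \<odot> y \<le> x.\<close>

lemma meet_times_absorb:
  assumes x: "x \<in> carrier A" and y: "y \<in> carrier A"
  shows "x \<^bold>\<and> (x \<odot> y) = x \<odot> y"
  using times_meet_distrib[OF x one_closed y] times_rules[OF x y] one_meet[OF y] by simp

lemma join_plus_absorb:
  assumes x: "x \<in> carrier A" and y: "y \<in> carrier A"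
  shows "x \<^bold>\<or> (x \<oplus> y) = x \<oplus> y"
  using plus_join_distrib[OF x zero_closed y] plus_rules[OF x y] zero_join[OF y] by simp

text \<open>The sum of x \<or> y with itself is x \<or> y by idempotence; by distributivity it is
  also the join of \<open>x\<close>, \<open>y\<close> and x \<oplus> y, in which the last
  dominates.\<close>

lemma plus_eq_join:
  assumes idem: "\<And>x. x \<in> carrier A \<Longrightarrow> x \<oplus> x = x"
    and x: "x \<in> carrier A" and y: "y \<in> carrier A"
  shows "x \<oplus> y = x \<^bold>\<or> y"
proof -
  have c: "x \<^bold>\<or> y \<in> carrier A" "x \<oplus> y \<in> carrier A"
    using x y by (simp_all add: join_closed plus_closed)
  have "x \<^bold>\<or> y = (x \<^bold>\<or> y) \<oplus> (x \<^bold>\<or> y)"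
    using idem c by simp
  also have "\<dots> = (x \<oplus> (x \<^bold>\<or> y)) \<^bold>\<or> (y \<oplus> (x \<^bold>\<or> y))"
    using plus_join_distrib[OF c(1) x y] plus_rules(3) c x y by simp
  also have "\<dots> = (x \<^bold>\<or> (x \<oplus> y)) \<^bold>\<or> ((x \<oplus> y) \<^bold>\<or> y)"
    using plus_join_distrib[OF x x y] plus_join_distrib[OF y x y] idem x y
      plus_rules(3)[OF x y] by simp
  also have "\<dots> = x \<oplus> y"
    using join_plus_absorb[OF x y] join_plus_absorb[OF y x] plus_rules(3)[OF x y]
      join_commute[OF c(2) y] join_idem[OF c(2)] by simp
  finally show ?thesis by simp
qed

text \<open>In \<open>C2_Delta\<close>, \<open>Top\<close> is the only element whose products with
  all elements other than \<open>Bot\<close> avoid \<open>Bot\<close>. If \<open>G\<close> is to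
  consist of the elements not sent to \<open>Bot\<close>, this set is the candidate for those sent
  to \<open>Top\<close>.\<close>

definition multiplier :: "'a set \<Rightarrow> 'a set" where
  "multiplier G = {x \<in> carrier A. \<forall>y\<in>G. x \<odot> y \<in> G}"

definition chain_map :: "'a set \<Rightarrow> 'a \<Rightarrow> chain3" where
  "chain_map G x = (if x \<in> multiplier G then Top else if x \<in> G then Mid else Bot)"

section \<open>Multipliers of a prime filter and the map they induce\<close>

context
  fixes G
  assumes idem: "\<And>x. x \<in> carrier A \<Longrightarrow> x \<oplus> x = x"
    and prime: "prime_filter G"
begin

lemma G_rules:
  shows "G \<subseteq> carrier A" "\<^bold>1 \<in> G" "\<^bold>0 \<notin> G"
    and "\<And>x y. x \<in> carrier A \<Longrightarrow> y \<in> carrier A \<Longrightarrow> x \<^bold>\<and> y \<in> G \<longleftrightarrow> x \<in> G \<and> y \<in> G"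
    and "\<And>x y. x \<in> carrier A \<Longrightarrow> y \<in> carrier A \<Longrightarrow> x \<^bold>\<or> y \<in> G \<longleftrightarrow> x \<in> G \<or> y \<in> G"
  using prime unfolding prime_filter_def lattice_filter_def by blast+

text \<open>Since 1 lies in \<open>G\<close>, a multiplier \<open>x\<close> has x = x \<odot> 1 in
  \<open>G\<close>. Hence \<open>chain_map G\<close> differs from \<open>Bot\<close> exactly on
  \<open>G\<close>.\<close>

lemma multiplier_subset: "multiplier G \<subseteq> G"
proof
  fix x assume "x \<in> multiplier G"
  then have x: "x \<in> carrier A" and "x \<odot> \<^bold>1 \<in> G"
    using G_rules(2) by (auto simp: multiplier_def)
  then show "x \<in> G" using times_rules(2)[OF x x] by simp
qed

lemma times_left_in_filter:
  assumes "x \<odot> y \<in> G" and x: "x \<in> carrier A" and y: "y \<in> carrier A"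
  shows "x \<in> G"
  using assms G_rules(4)[OF x times_closed[OF x y]] by (simp add: meet_times_absorb)

lemma times_left_distrib:
  assumes "x \<in> carrier A" "y \<in> carrier A" "z \<in> carrier A"
  shows "(x \<^bold>\<or> y) \<odot> z = (x \<odot> z) \<^bold>\<or> (y \<odot> z)" "(x \<^bold>\<and> y) \<odot> z = (x \<odot> z) \<^bold>\<and> (y \<odot> z)"
  using assms times_join_distrib[of z x y] times_meet_distrib[of z x y]
    times_rules(3)[of z x] times_rules(3)[of z y]
    times_rules(3)[of z "x \<^bold>\<or> y"] times_rules(3)[of z "x \<^bold>\<and> y"]
  by (simp_all add: join_closed meet_closed)

lemma multiplier_meet:
  assumes x: "x \<in> carrier A" and y: "y \<in> carrier A"
  shows "x \<^bold>\<and> y \<in> multiplier G \<longleftrightarrow> x \<in> multiplier G \<and> y \<in> multiplier G"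
proof -
  have "(x \<^bold>\<and> y) \<odot> z \<in> G \<longleftrightarrow> x \<odot> z \<in> G \<and> y \<odot> z \<in> G" if "z \<in> G" for z
    using that x y G_rules(1,4) times_left_distrib(2)[OF x y, of z] times_closed by auto
  then show ?thesis
    using x y by (auto simp: multiplier_def meet_closed)
qed

text \<open>Separate witnesses \<open>u\<close> and \<open>v\<close> are merged into their meet:
  \<odot> distributes over it, and a meet lies in \<open>G\<close> only if both parts do.\<close>

lemma not_multipliersE:
  assumes x: "x \<in> carrier A" "x \<notin> multiplier G" and y: "y \<in> carrier A" "y \<notin> multiplier G"
  obtains w where "w \<in> G" "x \<odot> w \<notin> G" "y \<odot> w \<notin> G"
proof -
  obtain u v where uv: "u \<in> G" "x \<odot> u \<notin> G" "v \<in> G" "y \<odot> v \<notin> G"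
    using x y by (auto simp: multiplier_def)
  have c: "u \<in> carrier A" "v \<in> carrier A"
    using uv G_rules(1) by auto
  show ?thesis
  proof
    show "u \<^bold>\<and> v \<in> G" using uv c G_rules(4) by simp
    show "x \<odot> (u \<^bold>\<and> v) \<notin> G" "y \<odot> (u \<^bold>\<and> v) \<notin> G"
      using uv c x y G_rules(4) by (simp_all add: times_meet_distrib times_closed)
  qed
qed

text \<open>For each \<open>z\<close> in \<open>G\<close> primality puts x \<odot> z or y \<odot> z
  in \<open>G\<close>, with a choice that may depend on \<open>z\<close>; the common witness from
  \<open>not_multipliersE\<close> removes this dependence.\<close>

lemma multiplier_join:
  assumes x: "x \<in> carrier A" and y: "y \<in> carrier A"
  shows "x \<^bold>\<or> y \<in> multiplier G \<longleftrightarrow> x \<in> multiplier G \<or> y \<in> multiplier G"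
proof -
  have *: "(x \<^bold>\<or> y) \<odot> z \<in> G \<longleftrightarrow> x \<odot> z \<in> G \<or> y \<odot> z \<in> G" if "z \<in> G" for z
    using that x y G_rules(1,5) times_left_distrib(1)[OF x y, of z] times_closed by auto
  show ?thesis
  proof
    assume m: "x \<^bold>\<or> y \<in> multiplier G"
    show "x \<in> multiplier G \<or> y \<in> multiplier G"
    proof (rule ccontr)
      assume "\<not> ?thesis"
      then obtain w where w: "w \<in> G" "x \<odot> w \<notin> G" "y \<odot> w \<notin> G"
        using not_multipliersE[OF x _ y] by blast
      with * m show False by (auto simp: multiplier_def)
    qed
  qed (use * x y in \<open>auto simp: multiplier_def join_closed\<close>)
qed

text \<open>Forward, x \<odot> y lies below both factors and multipliers form an up-set by
  \<open>multiplier_meet\<close>. Backward, multiplications by \<open>x\<close> and by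
  \<open>y\<close> compose.\<close>

lemma multiplier_times:
  assumes x: "x \<in> carrier A" and y: "y \<in> carrier A"
  shows "x \<odot> y \<in> multiplier G \<longleftrightarrow> x \<in> multiplier G \<and> y \<in> multiplier G"
proof
  assume "x \<odot> y \<in> multiplier G"
  then have "x \<^bold>\<and> (x \<odot> y) \<in> multiplier G" "y \<^bold>\<and> (x \<odot> y) \<in> multiplier G"
    using meet_times_absorb[OF x y] meet_times_absorb[OF y x] times_rules(3)[OF x y] by simp_all
  then show "x \<in> multiplier G \<and> y \<in> multiplier G"
    using multiplier_meet x y times_closed by blast
next
  assume "x \<in> multiplier G \<and> y \<in> multiplier G"
  moreover have "(x \<odot> y) \<odot> z = x \<odot> (y \<odot> z)" if "z \<in> G" for z
    using that times_assoc x y G_rules(1) by blast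
  ultimately show "x \<odot> y \<in> multiplier G"
    using x y by (auto simp: multiplier_def times_closed)
qed

text \<open>This mirrors \<open>C2_Delta\<close>, where a product avoids \<open>Bot\<close> only if
  one factor is \<open>Top\<close> and the other is not \<open>Bot\<close>. If neither factor were a
  multiplier, a common witness \<open>w\<close> would contradict \<open>mv_ax4\<close>.\<close>

lemma times_in_filter_iff:
  assumes x: "x \<in> carrier A" and y: "y \<in> carrier A"
  shows "x \<odot> y \<in> G \<longleftrightarrow> x \<in> multiplier G \<and> y \<in> G \<or> x \<in> G \<and> y \<in> multiplier G"
proof
  assume xy: "x \<odot> y \<in> G"
  then have "x \<in> G" "y \<in> G"
    using times_left_in_filter[OF _ x y] times_left_in_filter[OF _ y x] times_rules(3)[OF x y]
    by simp_all
  moreover have "x \<in> multiplier G \<or> y \<in> multiplier G"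
  proof (rule ccontr)
    assume "\<not> ?thesis"
    then obtain w where w: "w \<in> G" "x \<odot> w \<notin> G" "y \<odot> w \<notin> G"
      using not_multipliersE[OF x _ y] by blast
    have wc: "w \<in> carrier A" using w G_rules(1) by auto
    note c = times_closed[OF x y] times_closed[OF x wc] times_closed[OF y wc]
    \<comment> \<open>With \<open>\<oplus>\<close> equal to join, \<open>mv_ax4\<close> says that \<open>x \<odot> y \<^bold>\<and> w\<close> lies below
      \<open>x \<odot> w \<^bold>\<or> y \<odot> w\<close>.\<close>
    have "(x \<^bold>\<or> y) \<odot> w = ((x \<odot> y) \<^bold>\<or> ((x \<^bold>\<or> y) \<odot> w)) \<^bold>\<and> w"
      using mv_ax4[OF x y wc] x y wc
      by (simp add: plus_eq_join[OF idem] join_closed times_closed)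
    \<comment> \<open>The right side of the equation is in \<open>G\<close>: its join because x
      \<odot> y is, and \<open>w\<close> by choice.\<close>
    then have "(x \<^bold>\<or> y) \<odot> w \<in> G"
      using xy w c wc x y G_rules(4,5) by (metis join_closed times_closed)
    then show False
      using w c G_rules(5) times_left_distrib(1)[OF x y wc] by simp
  qed
  ultimately show "x \<in> multiplier G \<and> y \<in> G \<or> x \<in> G \<and> y \<in> multiplier G"
    by blast
next
  assume "x \<in> multiplier G \<and> y \<in> G \<or> x \<in> G \<and> y \<in> multiplier G"
  then show "x \<odot> y \<in> G"
    using times_rules(3)[OF x y] by (auto simp: multiplier_def)
qed

text \<open>An element of \<open>chain3\<close> is determined by whether it is \<open>Top\<close>
  and whether it is \<open>Bot\<close>. So it suffices to know when the result of an operation lies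
  in \<open>multiplier G\<close> and when in \<open>G\<close>; \<oplus> is the join on both
  sides.\<close>

lemma chain_map_hom: "chain_map G \<in> mv_hom A C2_Delta"
proof -
  have sub: "x \<in> G" if "x \<in> multiplier G" for x
    using that multiplier_subset by blast
  have "\<^bold>1 \<in> multiplier G"
    using G_rules(1) times_rules(1) by (auto simp: multiplier_def one_closed)
  moreover have "\<^bold>0 \<notin> multiplier G"
    using sub G_rules(3) by blast
  ultimately show ?thesis
    using sub G_rules(3)
    by (auto simp: mv_hom_def C2_Delta_def chain_map_def plus_eq_join[OF idem] multiplier_meet
        multiplier_join multiplier_times times_in_filter_iff G_rules(4,5))
qed

end

lemma hom_C2_Delta_separates:
  assumes idem: "\<And>x. x \<in> carrier A \<Longrightarrow> x \<oplus> x = x"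
    and a: "a \<in> carrier A" and b: "b \<in> carrier A" and ab: "a \<noteq> b"
  shows "\<exists>h \<in> mv_hom A C2_Delta. h a \<noteq> h b"
proof -
  \<comment> \<open>Distinct elements cannot each lie below the other.\<close>
  have "a \<^bold>\<and> b \<noteq> a \<or> b \<^bold>\<and> a \<noteq> b"
    using meet_commute[OF a b] ab by auto
  then obtain G where G: "prime_filter G" "a \<in> G \<longleftrightarrow> b \<notin> G"
    using prime_filter_exists[OF a b] prime_filter_exists[OF b a] by blast
  have "chain_map G a \<noteq> chain_map G b"
    using G(2) multiplier_subset[OF idem G(1)] by (auto simp: chain_map_def)
  then show ?thesis
    using chain_map_hom[OF idem G(1)] by blast
qed

end


section \<open>Order duality\<close>

text \<open>The carrier is kept, so one function can serve as a map on the algebra and on its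
  dual.\<close>

definition mv_dual :: "'a mv_alg \<Rightarrow> 'a mv_alg" where
  "mv_dual A = \<lparr>carrier = carrier A, mv_join = mv_meet A, mv_meet = mv_join A,
     mv_plus = mv_times A, mv_times = mv_plus A, mv_zero = mv_one A, mv_one = mv_zero A\<rparr>"

text \<open>The axioms come in dual pairs, such as \<open>mv_ax1\<close> with \<open>mv_ax2\<close>
  and \<open>mv_ax3\<close> with \<open>mv_ax4\<close>; the partner of
  \<open>meet_join_distrib\<close> is the derived \<open>join_meet_distrib\<close>.\<close>

lemma mv_monoid_dual:
  assumes "mv_monoid A"
  shows "mv_monoid (mv_dual A)"
proof -
  interpret mv_monoid A by fact
  show ?thesis
    unfolding mv_dual_def
  proof (rule mv_monoid.intro)
    show "mv_bounded_distrib_lattice \<lparr>carrier = carrier A, mv_join = mv_meet A,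
        mv_meet = mv_join A, mv_plus = mv_times A, mv_times = mv_plus A,
        mv_zero = mv_one A, mv_one = mv_zero A\<rparr>"
      by unfold_locales
        (simp_all add: join_closed meet_closed plus_closed times_closed zero_closed one_closed
          join_assoc meet_assoc join_meet_absorb meet_join_absorb join_meet_distrib
          zero_join one_meet, simp_all add: join_commute meet_commute)
    show "mv_monoid_axioms \<lparr>carrier = carrier A, mv_join = mv_meet A,
        mv_meet = mv_join A, mv_plus = mv_times A, mv_times = mv_plus A,
        mv_zero = mv_one A, mv_one = mv_zero A\<rparr>"
      \<comment> \<open>\<open>mv_ax3\<close> and \<open>mv_ax4\<close> are read from right to left
        because their left sides recur inside their right sides.\<close>
      by (rule mv_monoid_axioms.intro)
        (simp_all add: plus_comm_monoid times_comm_monoid plus_join_distrib plus_meet_distrib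
          times_join_distrib times_meet_distrib flip: mv_ax3 mv_ax4,
          simp_all add: mv_ax1 mv_ax2)
  qed
qed

primrec chain_flip :: "chain3 \<Rightarrow> chain3" where
  "chain_flip Bot = Top"
| "chain_flip Mid = Mid"
| "chain_flip Top = Bot"

lemma chain_flip_inject: "chain_flip x = chain_flip y \<longleftrightarrow> x = y"
  by (cases x; cases y) simp_all

text \<open>These laws make \<open>chain_flip\<close> an isomorphism from the dual of
  \<open>C2_Delta\<close> onto \<open>C2_Nabla\<close>.\<close>

lemma chain_flip_ops:
  "chain_flip (max x y) = min (chain_flip x) (chain_flip y)"
  "chain_flip (min x y) = max (chain_flip x) (chain_flip y)"
  "chain_flip (x \<oplus>\<^bsub>C2_Delta\<^esub> y) = chain_flip x \<odot>\<^bsub>C2_Nabla\<^esub> chain_flip y"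
  "chain_flip (x \<odot>\<^bsub>C2_Delta\<^esub> y) = chain_flip x \<oplus>\<^bsub>C2_Nabla\<^esub> chain_flip y"
  by (cases x; cases y; simp add: C2_Delta_def C2_Nabla_def)+

lemma hom_from_dual:
  assumes "h \<in> mv_hom (mv_dual A) C2_Delta"
  shows "chain_flip \<circ> h \<in> mv_hom A C2_Nabla"
proof -
  have C: "mv_join C2_Delta = max" "mv_meet C2_Delta = min" "\<^bold>0\<^bsub>C2_Delta\<^esub> = Bot"
    "\<^bold>1\<^bsub>C2_Delta\<^esub> = Top" "carrier C2_Nabla = UNIV" "mv_join C2_Nabla = max"
    "mv_meet C2_Nabla = min" "\<^bold>0\<^bsub>C2_Nabla\<^esub> = Bot" "\<^bold>1\<^bsub>C2_Nabla\<^esub> = Top"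
    by (simp_all add: C2_Delta_def C2_Nabla_def)
  show ?thesis
    using assms by (auto simp: mv_hom_def mv_dual_def C chain_flip_ops)
qed

text \<open>Idempotence of \<odot> is idempotence of \<oplus> in the dual, which therefore has a
  separating map to \<open>C2_Delta\<close>; flipping its values gives the required one.\<close>

lemma (in mv_monoid) hom_C2_Nabla_separates:
  assumes "\<And>x. x \<in> carrier A \<Longrightarrow> x \<odot> x = x"
    and "a \<in> carrier A" "b \<in> carrier A" "a \<noteq> b"
  shows "\<exists>h \<in> mv_hom A C2_Nabla. h a \<noteq> h b"
proof -
  interpret D: mv_monoid "mv_dual A"
    by (intro mv_monoid_dual mv_monoid_axioms)
  obtain h where "h \<in> mv_hom (mv_dual A) C2_Delta" "h a \<noteq> h b"
    using D.hom_C2_Delta_separates[of a b] assms by (auto simp: mv_dual_def)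
  then show ?thesis
    using hom_from_dual[of h A] by (intro bexI[of _ "chain_flip \<circ> h"])
      (simp_all add: chain_flip_inject)
qed


section \<open>Generated varieties\<close>

text \<open>An identity failing in \<open>A\<close> yields two distinct values. A homomorphism
  separating them carries the valuation to one at which the identity fails in a member of
  \<open>K\<close>.\<close>

lemma generated_variety_if_separating_homs:
  assumes K: "\<And>B. B \<in> K \<Longrightarrow> mv_algebra B" and A: "mv_algebra A"
    and sep: "\<And>a b. a \<in> carrier A \<Longrightarrow> b \<in> carrier A \<Longrightarrow> a \<noteq> b \<Longrightarrow>
      \<exists>B\<in>K. \<exists>h \<in> mv_hom A B. h a \<noteq> h b"
  shows "A \<in> generated_variety K"
proof -
  have "A \<Turnstile> e" if e: "\<forall>B\<in>K. B \<Turnstile> e" for e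
  proof (cases e)
    case (Identity s t)
    have "eval_term A v s = eval_term A v t" if v: "v \<in> UNIV \<rightarrow> carrier A" for v
    proof (rule ccontr)
      have v': "v i \<in> carrier A" for i using v by auto
      have closed: "eval_term A v u \<in> carrier A" for u
        by (rule eval_term_closed[OF A v'])
      assume "eval_term A v s \<noteq> eval_term A v t"
      then obtain B h where h: "B \<in> K" "h \<in> mv_hom A B"
          "h (eval_term A v s) \<noteq> h (eval_term A v t)"
        using sep[OF closed closed] by blast
      have "h \<circ> v \<in> UNIV \<rightarrow> carrier B"
        using h(2) v' by (auto simp: mv_hom_def)
      moreover have "\<forall>w \<in> UNIV \<rightarrow> carrier B. eval_term B w s = eval_term B w t"
        using h(1) e Identity by simp
      ultimately have "eval_term B (h \<circ> v) s = eval_term B (h \<circ> v) t"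
        by (rule bspec[rotated])
      then show False
        using h(3) eval_term_hom[OF A h(2), of v] v' by simp
    qed
    then show ?thesis using Identity by simp
  qed
  then show ?thesis
    using generated_variety_altdef[OF K] A by blast
qed

text \<open>The two commutative monoids are spelled out as commutativity, associativity and a left
  unit. Three variables suffice for every axiom.\<close>

definition mv_monoid_identities :: "mv_identity set" where
  "mv_monoid_identities = (let x = Var 0; y = Var 1; z = Var 2 in
    {Join x y \<approx> Join y x, Meet x y \<approx> Meet y x,
     Join (Join x y) z \<approx> Join x (Join y z), Meet (Meet x y) z \<approx> Meet x (Meet y z),
     Join x (Meet x y) \<approx> x, Meet x (Join x y) \<approx> x,
     Meet x (Join y z) \<approx> Join (Meet x y) (Meet x z),
     Join Zero x \<approx> x, Meet One x \<approx> x,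
     Plus x y \<approx> Plus y x, Plus (Plus x y) z \<approx> Plus x (Plus y z), Plus Zero x \<approx> x,
     Times x y \<approx> Times y x, Times (Times x y) z \<approx> Times x (Times y z), Times One x \<approx> x,
     Plus x (Join y z) \<approx> Join (Plus x y) (Plus x z),
     Plus x (Meet y z) \<approx> Meet (Plus x y) (Plus x z),
     Times x (Join y z) \<approx> Join (Times x y) (Times x z),
     Times x (Meet y z) \<approx> Meet (Times x y) (Times x z),
     Times (Plus x y) (Plus (Times x y) z) \<approx> Plus (Times x (Plus y z)) (Times y z),
     Plus (Times x y) (Times (Plus x y) z) \<approx> Times (Plus x (Times y z)) (Plus y z),
     Plus (Times x y) z \<approx> Join (Times (Plus x y) (Plus (Times x y) z)) z,
     Times (Plus x y) z \<approx> Meet (Plus (Times x y) (Times (Plus x y) z)) z})"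

lemma (in mv_monoid) satisfies_mv_monoid_identities:
  assumes "e \<in> mv_monoid_identities"
  shows "A \<Turnstile> e"
proof -
  have "\<forall>e \<in> mv_monoid_identities. A \<Turnstile> e"
    unfolding mv_monoid_identities_def Let_def ball_simps satisfies.simps eval_term.simps
    \<comment> \<open>A unit law concerns a single element, so 0 or 1 is supplied as the second
      element in \<open>plus_rules\<close> and \<open>times_rules\<close>.\<close>
    by (intro conjI ballI TrueI; rule join_commute meet_commute join_assoc meet_assoc
        join_meet_absorb meet_join_absorb meet_join_distrib zero_join one_meet
        plus_rules(3) plus_assoc plus_rules(1)[OF _ zero_closed]
        times_rules(3) times_assoc times_rules(1)[OF _ one_closed]
        plus_join_distrib plus_meet_distrib times_join_distrib times_meet_distrib
        mv_ax1 mv_ax2 mv_ax3 mv_ax4; simp add: Pi_iff)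
  then show ?thesis using assms by blast
qed

lemma mv_monoidI_identities:
  assumes "mv_algebra A" and sat: "\<And>e. e \<in> mv_monoid_identities \<Longrightarrow> A \<Turnstile> e"
  shows "mv_monoid A"
proof -
  interpret mv_algebra A by fact
  \<comment> \<open>The valuation sends variables 0 and 1 to \<open>x\<close> and \<open>y\<close>
    and all others, among them 2, to \<open>z\<close>, so one evaluation yields every axiom at
    \<open>x\<close>, \<open>y\<close>, \<open>z\<close>.\<close>
  have "\<forall>e \<in> mv_monoid_identities. case e of Identity s t \<Rightarrow>
      eval_term A ((\<lambda>_. z)(0 := x, 1 := y)) s = eval_term A ((\<lambda>_. z)(0 := x, 1 := y)) t"
    if "x \<in> carrier A" "y \<in> carrier A" "z \<in> carrier A" for x y z
  proof -
    have v: "(\<lambda>_. z)(0 := x, 1 := y) \<in> UNIV \<rightarrow> carrier A"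
      using that by auto
    show ?thesis
    proof
      fix e assume "e \<in> mv_monoid_identities"
      then have "A \<Turnstile> e" by (rule sat)
      then show "case e of Identity s t \<Rightarrow>
          eval_term A ((\<lambda>_. z)(0 := x, 1 := y)) s = eval_term A ((\<lambda>_. z)(0 := x, 1 := y)) t"
        using bspec[OF _ v] by (cases e) (simp only: satisfies.simps mv_identity.case)
    qed
  qed
  note laws = this[unfolded mv_monoid_identities_def Let_def, simplified]
  show ?thesis
  proof (intro mv_monoid.intro mv_bounded_distrib_lattice.intro mv_monoid_axioms.intro
      mv_bounded_distrib_lattice_axioms.intro mv_algebra_axioms)
    show "comm_monoid \<lparr>carrier = carrier A, mult = mv_plus A, one = \<^bold>0\<^bsub>A\<^esub>\<rparr>"
      by (rule comm_monoidI; simp add: plus_closed zero_closed;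
          frule (2) laws, elim conjE, assumption)
    show "comm_monoid \<lparr>carrier = carrier A, mult = mv_times A, one = \<^bold>1\<^bsub>A\<^esub>\<rparr>"
      by (rule comm_monoidI; simp add: times_closed one_closed;
          frule (2) laws, elim conjE, assumption)
  qed (frule (2) laws, elim conjE, assumption)+
qed

text \<open>The class \<open>Mod mv_monoid_identities\<close> is a variety containing
  \<open>K\<close>, hence it contains the generated one.\<close>

lemma generated_variety_mv_monoid:
  assumes K: "\<And>B. B \<in> K \<Longrightarrow> mv_monoid B" and A: "A \<in> generated_variety K"
  shows "mv_monoid A"
proof -
  have "mv_algebra B" if "B \<in> K" for B
    using K[OF that] by (simp add: mv_monoid_def mv_bounded_distrib_lattice_def)
  then have "K \<subseteq> Mod mv_monoid_identities"
    using K mv_monoid.satisfies_mv_monoid_identities by (auto simp: Mod_def)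
  then have "A \<in> Mod mv_monoid_identities"
    using A unfolding generated_variety_def by blast
  then show ?thesis
    by (intro mv_monoidI_identities) (auto simp: Mod_def)
qed

section \<open>The two varieties as classes of idempotent MV-monoids\<close>

theorem theorem8p20:
  "(generated_variety {C2_Delta} :: 'a mv_alg set)
      = {A. mv_monoid A \<and> A \<Turnstile> (Plus (Var 0) (Var 0) \<approx> Var 0)}
   \<and> (generated_variety {C2_Nabla} :: 'a mv_alg set)
      = {A. mv_monoid A \<and> A \<Turnstile> (Times (Var 0) (Var 0) \<approx> Var 0)}"
proof (intro conjI equalityI subsetI CollectI)
  have alg: "mv_algebra C2_Delta" "mv_algebra C2_Nabla"
    using mv_monoid_C2_Delta mv_monoid_C2_Nabla
    by (simp_all add: mv_monoid_def mv_bounded_distrib_lattice_def)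
  have idem: "C2_Delta \<Turnstile> (Plus (Var 0) (Var 0) \<approx> Var 0)"
    "C2_Nabla \<Turnstile> (Times (Var 0) (Var 0) \<approx> Var 0)"
    by (auto simp: C2_Delta_def C2_Nabla_def) (metis chain3.exhaust)+
  fix A :: "'a mv_alg"
  show "mv_monoid A" if "A \<in> generated_variety {C2_Delta}"
    using generated_variety_mv_monoid[OF _ that] mv_monoid_C2_Delta by blast
  show "mv_monoid A" if "A \<in> generated_variety {C2_Nabla}"
    using generated_variety_mv_monoid[OF _ that] mv_monoid_C2_Nabla by blast
  \<comment> \<open>Identities of the generator pass to the whole generated variety.\<close>
  show "A \<Turnstile> (Plus (Var 0) (Var 0) \<approx> Var 0)" if "A \<in> generated_variety {C2_Delta}"
    using that idem(1) alg generated_variety_altdef[of "{C2_Delta}" A] by blast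
  show "A \<Turnstile> (Times (Var 0) (Var 0) \<approx> Var 0)" if "A \<in> generated_variety {C2_Nabla}"
    using that idem(2) alg generated_variety_altdef[of "{C2_Nabla}" A] by blast
  {
    assume A: "A \<in> {A. mv_monoid A \<and> A \<Turnstile> (Plus (Var 0) (Var 0) \<approx> Var 0)}"
    then interpret mv_monoid A by blast
    \<comment> \<open>The constant valuation at \<open>x\<close> turns the identity into idempotence
      of \<open>x\<close>.\<close>
    have "x \<oplus>\<^bsub>A\<^esub> x = x" if "x \<in> carrier A" for x
      using A that by (auto dest: bspec[of _ _ "\<lambda>_. x"])
    then show "A \<in> generated_variety {C2_Delta}"
      using hom_C2_Delta_separates alg mv_algebra_axioms
      by (intro generated_variety_if_separating_homs) auto
  }
  {
    assume A: "A \<in> {A. mv_monoid A \<and> A \<Turnstile> (Times (Var 0) (Var 0) \<approx> Var 0)}"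
    then interpret mv_monoid A by blast
    have "x \<odot>\<^bsub>A\<^esub> x = x" if "x \<in> carrier A" for x
      using A that by (auto dest: bspec[of _ _ "\<lambda>_. x"])
    then show "A \<in> generated_variety {C2_Nabla}"
      using hom_C2_Nabla_separates alg mv_algebra_axioms
      by (intro generated_variety_if_separating_homs) auto
  }
qed

end
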